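(* There exist a bounded linear operator $T$ on a Hilbert space $H$, a bounded open set $\Omega\subset\mathbb{C}$ with $\sigma(T)\subset\Omega$, and a holomorphic function $f\colon\Omega\to\mathbb{C}$ with $f'\ne 0$ on $\Omega$, such that the root spaces of $f(T)$ form an unconditional (Riesz) basis in $H$, whereas the root spaces of $T$ are not a Riesz basis of $H$.
   Context: Hilbert spaces are complex and separable. $f(T)$ is defined by the Riesz--Dunford functional calculus. For a bounded operator $A$ on $H$, $\sigma_p(A)$ is its point spectrum, and the root space of $A$ at $\lambda$ is $R_A(\lambda)=\operatorname{clos}\bigcup_{j\ge1}\ker(A-\lambda)^j$; the root spaces of $A$ are the spaces $R_A(\lambda)$, $\lambda\in\sigma_p(A)$. A countable family $\{X_\alpha\}_{\alpha\in I}$ of linearly independent subspaces of $H$ is an unconditional basis in $H$ if its linear span is dense in $H$ and there is a constant $C>0$ such that $\big\|\sum_{\alpha\in F_1}x_\alpha\big\|\le C\big\|\sum_{\alpha\in F_2}x_\alpha\big\|$ for all finite subsets $F_1\subset F_2$ of $I$ and all $x_\alpha\in X_\alpha$. In a Hilbert space, a Riesz basis of subspaces is the same as an unconditional basis of subspaces. Saying that the root spaces of an operator form an unconditional basis includes the requirement that its point spectrum is countable. *)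

theory Defs
  imports "HOL-Complex_Analysis.Complex_Analysis"
begin

section \<open>Complex Hilbert spaces\<close>

class complex_vector = real_vector +
  fixes scaleC :: "complex \<Rightarrow> 'a \<Rightarrow> 'a"  (infixr \<open>*\<^sub>C\<close> 75)
  assumes scaleC_add_right: "c *\<^sub>C (x + y) = c *\<^sub>C x + c *\<^sub>C y"
    and scaleC_add_left: "(c + d) *\<^sub>C x = c *\<^sub>C x + d *\<^sub>C x"
    and scaleC_scaleC: "c *\<^sub>C (d *\<^sub>C x) = (c * d) *\<^sub>C x"
    and scaleC_one: "1 *\<^sub>C x = x"
    and scaleR_scaleC: "r *\<^sub>R x = complex_of_real r *\<^sub>C x"

text \<open>
  The complex inner product is linear in its first argument. Positive definiteness and the
  norm come from \<^class>\<open>real_inner\<close>, whose inner product is the real part of the complex one.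
\<close>

class complex_inner = complex_vector + real_inner +
  fixes cinner :: "'a \<Rightarrow> 'a \<Rightarrow> complex"
  assumes cinner_commute: "cinner x y = cnj (cinner y x)"
    and cinner_add_left: "cinner (x + y) z = cinner x z + cinner y z"
    and cinner_scaleC_left: "cinner (c *\<^sub>C x) y = c * cinner x y"
    and Re_cinner: "Re (cinner x y) = inner x y"

class chilbert_space = complex_inner + complete_space

definition csubspace :: "'a::complex_vector set \<Rightarrow> bool" where
  "csubspace V \<longleftrightarrow> 0 \<in> V \<and> (\<forall>x\<in>V. \<forall>y\<in>V. x + y \<in> V) \<and> (\<forall>c. \<forall>x\<in>V. c *\<^sub>C x \<in> V)"

text \<open>
  A separable Hilbert space is carried by a closed subspace of a Hilbert space type. For the
  type \<open>ell2\<close> below, these subspaces exhaust all complex separable Hilbert spaces, of finite or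
  infinite dimension, up to unitary equivalence.
\<close>

definition separable_hilbert :: "'a::chilbert_space set \<Rightarrow> bool" where
  "separable_hilbert H \<longleftrightarrow> csubspace H \<and> closed H \<and>
     (\<exists>D. countable D \<and> D \<subseteq> H \<and> H \<subseteq> closure D)"

section \<open>The sequence space of square-summable complex sequences\<close>

typedef ell2 = "{x :: nat \<Rightarrow> complex. summable (\<lambda>k. (cmod (x k))\<^sup>2)}"
  morphisms ell2_nth Abs_ell2
  by (rule exI[of _ "\<lambda>_. 0"]) simp

setup_lifting type_definition_ell2

lemma ell2_eqI: "(\<And>k. ell2_nth x k = ell2_nth y k) \<Longrightarrow> x = y"
  by (metis ell2_nth_inject ext)

lemma ell2_summable: "summable (\<lambda>k. (cmod (ell2_nth x k))\<^sup>2)"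
  using ell2_nth[of x] by simp

lemma summable_sq_add:
  fixes x y :: "nat \<Rightarrow> complex"
  assumes "summable (\<lambda>k. (cmod (x k))\<^sup>2)" "summable (\<lambda>k. (cmod (y k))\<^sup>2)"
  shows "summable (\<lambda>k. (cmod (x k + y k))\<^sup>2)"
proof (rule summable_comparison_test')
  show "summable (\<lambda>k. 2 * (cmod (x k))\<^sup>2 + 2 * (cmod (y k))\<^sup>2)"
    by (intro summable_add summable_mult assms)
  fix k
  have "(cmod (x k + y k))\<^sup>2 \<le> (cmod (x k) + cmod (y k))\<^sup>2"
    by (intro power_mono norm_triangle_ineq) auto
  also have "\<dots> \<le> 2 * (cmod (x k))\<^sup>2 + 2 * (cmod (y k))\<^sup>2"
    using sum_squares_bound[of "cmod (x k)" "cmod (y k)"] by (simp add: power2_sum)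
  finally show "norm ((cmod (x k + y k))\<^sup>2) \<le> 2 * (cmod (x k))\<^sup>2 + 2 * (cmod (y k))\<^sup>2"
    by simp
qed

lemma summable_sq_scale:
  fixes x :: "nat \<Rightarrow> complex"
  assumes "summable (\<lambda>k. (cmod (x k))\<^sup>2)"
  shows "summable (\<lambda>k. (cmod (c * x k))\<^sup>2)"
  using summable_mult[OF assms, of "(cmod c)\<^sup>2"] by (simp add: norm_mult power_mult_distrib)

lemma summable_sq_mult:
  fixes x y :: "nat \<Rightarrow> complex"
  assumes "summable (\<lambda>k. (cmod (x k))\<^sup>2)" "summable (\<lambda>k. (cmod (y k))\<^sup>2)"
  shows "summable (\<lambda>k. x k * cnj (y k))"
proof (rule summable_comparison_test')
  show "summable (\<lambda>k. (cmod (x k))\<^sup>2 + (cmod (y k))\<^sup>2)"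
    by (intro summable_add assms)
  fix k
  have "cmod (x k) * cmod (y k) \<le> 2 * cmod (x k) * cmod (y k)"
    by simp
  also have "\<dots> \<le> (cmod (x k))\<^sup>2 + (cmod (y k))\<^sup>2"
    by (rule sum_squares_bound)
  finally show "norm (x k * cnj (y k)) \<le> (cmod (x k))\<^sup>2 + (cmod (y k))\<^sup>2"
    by (simp add: norm_mult)
qed

instantiation ell2 :: complex_vector
begin

lift_definition zero_ell2 :: ell2 is "\<lambda>_. 0" by simp

lift_definition plus_ell2 :: "ell2 \<Rightarrow> ell2 \<Rightarrow> ell2" is "\<lambda>x y k. x k + y k"
  by (rule summable_sq_add)

lift_definition uminus_ell2 :: "ell2 \<Rightarrow> ell2" is "\<lambda>x k. - x k" by simp

lift_definition minus_ell2 :: "ell2 \<Rightarrow> ell2 \<Rightarrow> ell2" is "\<lambda>x y k. x k - y k"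
  using summable_sq_add[of _ "\<lambda>k. - _ k"] by simp

lift_definition scaleC_ell2 :: "complex \<Rightarrow> ell2 \<Rightarrow> ell2" is "\<lambda>c x k. c * x k"
  by (rule summable_sq_scale)

lift_definition scaleR_ell2 :: "real \<Rightarrow> ell2 \<Rightarrow> ell2" is "\<lambda>r x k. complex_of_real r * x k"
  by (rule summable_sq_scale)

instance
  by standard (transfer; simp add: algebra_simps)+

end

instantiation ell2 :: complex_inner
begin

definition cinner_ell2 :: "ell2 \<Rightarrow> ell2 \<Rightarrow> complex" where
  "cinner_ell2 x y = (\<Sum>k. ell2_nth x k * cnj (ell2_nth y k))"

definition inner_ell2 :: "ell2 \<Rightarrow> ell2 \<Rightarrow> real" where
  "inner_ell2 x y = Re (cinner x y)"

definition norm_ell2 :: "ell2 \<Rightarrow> real" where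
  "norm_ell2 x = sqrt (inner x x)"

definition sgn_ell2 :: "ell2 \<Rightarrow> ell2" where
  "sgn_ell2 x = x /\<^sub>R norm x"

definition dist_ell2 :: "ell2 \<Rightarrow> ell2 \<Rightarrow> real" where
  "dist_ell2 x y = norm (x - y)"

definition uniformity_ell2 :: "(ell2 \<times> ell2) filter" where
  "uniformity_ell2 = (INF e\<in>{0<..}. principal {(x, y). dist x y < e})"

definition open_ell2 :: "ell2 set \<Rightarrow> bool" where
  "open_ell2 U \<longleftrightarrow> (\<forall>x\<in>U. eventually (\<lambda>(x', y). x' = x \<longrightarrow> y \<in> U) uniformity)"

lemma ell2_summable_mult: "summable (\<lambda>k. ell2_nth x k * cnj (ell2_nth y k))"
  by (intro summable_sq_mult ell2_summable)

lemma ell2_inner_self: "inner x x = (\<Sum>k. (cmod (ell2_nth x k))\<^sup>2)"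
proof -
  have "inner x x = (\<Sum>k. Re (ell2_nth x k * cnj (ell2_nth x k)))"
    unfolding inner_ell2_def cinner_ell2_def by (rule Re_suminf[OF ell2_summable_mult])
  also have "\<dots> = (\<Sum>k. (cmod (ell2_nth x k))\<^sup>2)"
    by (intro suminf_cong) (simp add: cmod_power2 flip: power2_eq_square)
  finally show ?thesis .
qed

instance
proof
  fix x y z :: ell2 and c :: complex and r :: real and U :: "ell2 set"
  show "dist x y = norm (x - y)" by (rule dist_ell2_def)
  show "sgn x = x /\<^sub>R norm x" by (rule sgn_ell2_def)
  show "norm x = sqrt (inner x x)" by (rule norm_ell2_def)
  show "uniformity = (INF e\<in>{0<..}. principal {(x::ell2, y). dist x y < e})"
    by (rule uniformity_ell2_def)
  show "open U \<longleftrightarrow> (\<forall>x\<in>U. eventually (\<lambda>(x', y). x' = x \<longrightarrow> y \<in> U) uniformity)"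
    by (rule open_ell2_def)
  show comm: "cinner x y = cnj (cinner y x)" for x y :: ell2
  proof -
    have "(\<lambda>k. cnj (ell2_nth y k * cnj (ell2_nth x k))) sums cnj (cinner y x)"
      unfolding cinner_ell2_def sums_cnj by (rule summable_sums[OF ell2_summable_mult])
    then show ?thesis
      unfolding cinner_ell2_def by (simp add: sums_iff mult.commute)
  qed
  show add: "cinner (x + y) z = cinner x z + cinner y z" for x y z :: ell2
    unfolding cinner_ell2_def
    by (subst suminf_add) (auto simp: ell2_summable_mult plus_ell2.rep_eq algebra_simps)
  show scale: "cinner (c *\<^sub>C x) y = c * cinner x y" for c and x y :: ell2
    unfolding cinner_ell2_def
    by (subst suminf_mult[symmetric]) (auto simp: ell2_summable_mult scaleC_ell2.rep_eq algebra_simps)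
  show "Re (cinner x y) = inner x y" by (simp add: inner_ell2_def)
  show "inner x y = inner y x"
    unfolding inner_ell2_def by (subst comm) simp
  show "inner (x + y) z = inner x z + inner y z"
    by (simp add: inner_ell2_def add)
  show "inner (r *\<^sub>R x) y = r * inner x y"
    by (simp add: inner_ell2_def scaleR_scaleC scale)
  show "0 \<le> inner x x"
    unfolding ell2_inner_self by (intro suminf_nonneg ell2_summable) simp
  show "inner x x = 0 \<longleftrightarrow> x = 0"
  proof
    assume "inner x x = 0"
    then have "\<forall>k. (cmod (ell2_nth x k))\<^sup>2 = 0"
      unfolding ell2_inner_self by (subst (asm) suminf_eq_zero_iff) (auto simp: ell2_summable)
    then show "x = 0"
      by (intro ell2_eqI) (simp add: zero_ell2.rep_eq)
  next
    assume "x = 0"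
    then show "inner x x = 0"
      unfolding ell2_inner_self by (simp add: zero_ell2.rep_eq)
  qed
qed

end

lemma ell2_norm_sq: "(norm x)\<^sup>2 = (\<Sum>k. (cmod (ell2_nth x k))\<^sup>2)"
  unfolding power2_norm_eq_inner[of x] by (rule ell2_inner_self)

lemma ell2_partial_le: "(\<Sum>k<K. (cmod (ell2_nth x k))\<^sup>2) \<le> (norm x)\<^sup>2"
  unfolding ell2_norm_sq by (intro sum_le_suminf ell2_summable) auto

lemma ell2_nth_le: "cmod (ell2_nth x k) \<le> norm x"
proof -
  have "(cmod (ell2_nth x k))\<^sup>2 \<le> (\<Sum>i<Suc k. (cmod (ell2_nth x i))\<^sup>2)"
    by (simp add: sum_nonneg)
  also have "\<dots> \<le> (norm x)\<^sup>2" by (rule ell2_partial_le)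
  finally show ?thesis by (simp add: power2_le_iff_abs_le)
qed

instance ell2 :: chilbert_space
proof
  fix X :: "nat \<Rightarrow> ell2"
  assume X: "Cauchy X"
  have "Cauchy (\<lambda>n. ell2_nth (X n) k)" for k
  proof (rule CauchyI)
    fix e :: real assume "0 < e"
    then obtain M where M: "\<forall>m\<ge>M. \<forall>n\<ge>M. norm (X m - X n) < e"
      using CauchyD[OF X] by blast
    have "norm (ell2_nth (X m) k - ell2_nth (X n) k) < e" if "m \<ge> M" "n \<ge> M" for m n
      using ell2_nth_le[of "X m - X n" k] M that by (fastforce simp: minus_ell2.rep_eq)
    then show "\<exists>M. \<forall>m\<ge>M. \<forall>n\<ge>M. norm (ell2_nth (X m) k - ell2_nth (X n) k) < e"
      by blast
  qed
  then have "\<forall>k. \<exists>a. (\<lambda>n. ell2_nth (X n) k) \<longlonglongrightarrow> a"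
    using Cauchy_convergent convergent_def by blast
  then obtain a where a: "\<And>k. (\<lambda>n. ell2_nth (X n) k) \<longlonglongrightarrow> a k"
    by metis
  have tail: "(\<Sum>k<K. (cmod (ell2_nth (X m) k - a k))\<^sup>2) \<le> e\<^sup>2"
    if M: "\<forall>m\<ge>M. \<forall>n\<ge>M. norm (X m - X n) < e" and m: "m \<ge> M" for e M m K
  proof (rule tendsto_upperbound)
    show "(\<lambda>n. \<Sum>k<K. (cmod (ell2_nth (X m) k - ell2_nth (X n) k))\<^sup>2)
        \<longlonglongrightarrow> (\<Sum>k<K. (cmod (ell2_nth (X m) k - a k))\<^sup>2)"
      by (intro tendsto_intros a)
    show "\<forall>\<^sub>F n in sequentially. (\<Sum>k<K. (cmod (ell2_nth (X m) k - ell2_nth (X n) k))\<^sup>2) \<le> e\<^sup>2"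
    proof (rule eventually_sequentiallyI)
      fix n assume "M \<le> n"
      have "(\<Sum>k<K. (cmod (ell2_nth (X m) k - ell2_nth (X n) k))\<^sup>2) \<le> (norm (X m - X n))\<^sup>2"
        using ell2_partial_le[of "X m - X n" K] by (simp add: minus_ell2.rep_eq)
      also have "\<dots> \<le> e\<^sup>2"
        using M m \<open>M \<le> n\<close> by (intro power_mono) (auto intro: less_imp_le)
      finally show "(\<Sum>k<K. (cmod (ell2_nth (X m) k - ell2_nth (X n) k))\<^sup>2) \<le> e\<^sup>2" .
    qed
  qed simp
  have summ: "summable (\<lambda>k. (cmod (ell2_nth (X m) k - a k))\<^sup>2)"
    and bound: "(\<Sum>k. (cmod (ell2_nth (X m) k - a k))\<^sup>2) \<le> e\<^sup>2"
    if M: "\<forall>m\<ge>M. \<forall>n\<ge>M. norm (X m - X n) < e" and m: "m \<ge> M" for e M m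
  proof -
    show s: "summable (\<lambda>k. (cmod (ell2_nth (X m) k - a k))\<^sup>2)"
    proof (rule summableI_nonneg_bounded)
      show "(\<Sum>k<K. (cmod (ell2_nth (X m) k - a k))\<^sup>2) \<le> e\<^sup>2" for K
        by (rule tail[OF M m])
    qed simp
    show "(\<Sum>k. (cmod (ell2_nth (X m) k - a k))\<^sup>2) \<le> e\<^sup>2"
      by (rule suminf_le_const[OF s tail[OF M m]])
  qed
  obtain M where M: "\<forall>m\<ge>M. \<forall>n\<ge>M. norm (X m - X n) < 1"
    using CauchyD[OF X, of 1] by auto
  have "summable (\<lambda>k. (cmod (ell2_nth (X M) k + - (ell2_nth (X M) k - a k)))\<^sup>2)"
    using summ[OF M order_refl] by (intro summable_sq_add ell2_summable) (simp add: norm_minus_commute)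
  then have sa: "summable (\<lambda>k. (cmod (a k))\<^sup>2)"
    by simp
  then have L: "ell2_nth (Abs_ell2 a) = a"
    by (simp add: Abs_ell2_inverse)
  have "X \<longlonglongrightarrow> Abs_ell2 a"
  proof (rule LIMSEQ_I)
    fix r :: real assume r: "0 < r"
    then obtain N where N: "\<forall>m\<ge>N. \<forall>n\<ge>N. norm (X m - X n) < r / 2"
      using CauchyD[OF X, of "r / 2"] by auto
    have "norm (X n - Abs_ell2 a) < r" if "n \<ge> N" for n
    proof -
      have "(norm (X n - Abs_ell2 a))\<^sup>2 \<le> (r / 2)\<^sup>2"
        using bound[OF N that] by (simp add: ell2_norm_sq minus_ell2.rep_eq L)
      then have "norm (X n - Abs_ell2 a) \<le> r / 2"
        using r by (simp add: power2_le_iff_abs_le)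
      then show ?thesis using r by simp
    qed
    then show "\<exists>N. \<forall>n\<ge>N. norm (X n - Abs_ell2 a) < r" by blast
  qed
  then show "convergent X" by (rule convergentI)
qed

section \<open>Bounded operators and the Riesz--Dunford functional calculus\<close>

text \<open>
  An operator on a Hilbert space \<open>H\<close> is a function on the ambient type of which only the values
  on \<open>H\<close> matter.
\<close>

definition bounded_op_on :: "'a::chilbert_space set \<Rightarrow> ('a \<Rightarrow> 'a) \<Rightarrow> bool" where
  "bounded_op_on H T \<longleftrightarrow>
     (\<forall>x\<in>H. T x \<in> H) \<and>
     (\<forall>x\<in>H. \<forall>y\<in>H. T (x + y) = T x + T y) \<and>
     (\<forall>c. \<forall>x\<in>H. T (c *\<^sub>C x) = c *\<^sub>C T x) \<and>
     (\<exists>K. \<forall>x\<in>H. norm (T x) \<le> K * norm x)"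

definition is_resolvent :: "'a::chilbert_space set \<Rightarrow> ('a \<Rightarrow> 'a) \<Rightarrow> complex \<Rightarrow> ('a \<Rightarrow> 'a) \<Rightarrow> bool" where
  "is_resolvent H T z R \<longleftrightarrow> bounded_op_on H R \<and>
     (\<forall>x\<in>H. R (z *\<^sub>C x - T x) = x \<and> z *\<^sub>C R x - T (R x) = x)"

definition spectrum_on :: "'a::chilbert_space set \<Rightarrow> ('a \<Rightarrow> 'a) \<Rightarrow> complex set" where
  "spectrum_on H T = {z. \<nexists>R. is_resolvent H T z R}"

definition resolvent_on :: "'a::chilbert_space set \<Rightarrow> ('a \<Rightarrow> 'a) \<Rightarrow> complex \<Rightarrow> 'a \<Rightarrow> 'a" where
  "resolvent_on H T z = (SOME R. is_resolvent H T z R)"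

definition point_spectrum_on :: "'a::chilbert_space set \<Rightarrow> ('a \<Rightarrow> 'a) \<Rightarrow> complex set" where
  "point_spectrum_on H T = {z. \<exists>x\<in>H. x \<noteq> 0 \<and> T x = z *\<^sub>C x}"

definition vec_contour_integral :: "(real \<Rightarrow> complex) \<Rightarrow> (complex \<Rightarrow> 'a::chilbert_space) \<Rightarrow> 'a" where
  "vec_contour_integral \<gamma> F =
     integral {0..1} (\<lambda>t. vector_derivative \<gamma> (at t within {0..1}) *\<^sub>C F (\<gamma> t))"

text \<open>
  The list of closed paths \<open>\<Gamma>\<close> is a contour surrounding \<open>S\<close> within \<open>\<Omega>\<close>. A single path would
  not suffice, since neither \<open>S\<close> nor \<open>\<Omega>\<close> need be connected.
\<close>

definition surrounds_within :: "(real \<Rightarrow> complex) list \<Rightarrow> complex set \<Rightarrow> complex set \<Rightarrow> bool" where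
  "surrounds_within \<Gamma> S \<Omega> \<longleftrightarrow>
     (\<forall>\<gamma>\<in>set \<Gamma>. valid_path \<gamma> \<and> pathfinish \<gamma> = pathstart \<gamma> \<and> path_image \<gamma> \<subseteq> \<Omega> - S) \<and>
     (\<forall>z\<in>S. (\<Sum>\<gamma>\<leftarrow>\<Gamma>. winding_number \<gamma> z) = 1) \<and>
     (\<forall>z. z \<notin> \<Omega> \<longrightarrow> (\<Sum>\<gamma>\<leftarrow>\<Gamma>. winding_number \<gamma> z) = 0)"

text \<open>
  \<open>A = f(T)\<close>, i.e. \<open>A = (2\<pi>\<i>)\<^sup>-\<^sup>1 \<integral>\<^sub>\<Gamma> f(z) (z - T)\<^sup>-\<^sup>1 dz\<close>, for \<open>f\<close> holomorphic on the open set
  \<open>\<Omega>\<close> containing the spectrum of \<open>T\<close>. By Cauchy's theorem the integral does not depend on the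
  choice of \<open>\<Gamma>\<close>, so that at most one operator \<open>A\<close> on \<open>H\<close> is so related to \<open>T\<close> and \<open>f\<close>. The
  integrand is continuous in operator norm along \<open>\<Gamma>\<close>, hence applying the operator-valued
  integral to \<open>x\<close> amounts to integrating the values at \<open>x\<close>.
\<close>

definition riesz_dunford ::
  "'a::chilbert_space set \<Rightarrow> ('a \<Rightarrow> 'a) \<Rightarrow> complex set \<Rightarrow> (complex \<Rightarrow> complex) \<Rightarrow> ('a \<Rightarrow> 'a) \<Rightarrow> bool"
where
  "riesz_dunford H T \<Omega> f A \<longleftrightarrow> bounded_op_on H A \<and>
     (\<exists>\<Gamma>. surrounds_within \<Gamma> (spectrum_on H T) \<Omega> \<and>
       (\<forall>x\<in>H. A x = (1 / (2 * of_real pi * \<i>)) *\<^sub>C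
          (\<Sum>\<gamma>\<leftarrow>\<Gamma>. vec_contour_integral \<gamma> (\<lambda>z. f z *\<^sub>C resolvent_on H T z x))))"

section \<open>Root spaces and unconditional bases of subspaces\<close>

definition root_space_on :: "'a::chilbert_space set \<Rightarrow> ('a \<Rightarrow> 'a) \<Rightarrow> complex \<Rightarrow> 'a set" where
  "root_space_on H A z = closure (\<Union>j\<in>{1..}. {x\<in>H. ((\<lambda>y. A y - z *\<^sub>C y) ^^ j) x = 0})"

definition lin_indep_subspaces :: "'i set \<Rightarrow> ('i \<Rightarrow> 'a::complex_vector set) \<Rightarrow> bool" where
  "lin_indep_subspaces I X \<longleftrightarrow>
     (\<forall>F x. finite F \<and> F \<subseteq> I \<and> (\<forall>\<alpha>\<in>F. x \<alpha> \<in> X \<alpha>) \<and> (\<Sum>\<alpha>\<in>F. x \<alpha>) = 0 \<longrightarrow> (\<forall>\<alpha>\<in>F. x \<alpha> = 0))"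

definition span_subspaces :: "'i set \<Rightarrow> ('i \<Rightarrow> 'a::complex_vector set) \<Rightarrow> 'a set" where
  "span_subspaces I X = {\<Sum>\<alpha>\<in>F. x \<alpha> | F x. finite F \<and> F \<subseteq> I \<and> (\<forall>\<alpha>\<in>F. x \<alpha> \<in> X \<alpha>)}"

definition unconditional_basis ::
  "'a::chilbert_space set \<Rightarrow> 'i set \<Rightarrow> ('i \<Rightarrow> 'a set) \<Rightarrow> bool" where
  "unconditional_basis H I X \<longleftrightarrow>
     countable I \<and>
     (\<forall>\<alpha>\<in>I. csubspace (X \<alpha>) \<and> X \<alpha> \<subseteq> H) \<and>
     lin_indep_subspaces I X \<and>
     H \<subseteq> closure (span_subspaces I X) \<and>
     (\<exists>C>0. \<forall>F\<^sub>1 F\<^sub>2 x. finite F\<^sub>2 \<and> F\<^sub>1 \<subseteq> F\<^sub>2 \<and> F\<^sub>2 \<subseteq> I \<and> (\<forall>\<alpha>\<in>F\<^sub>2. x \<alpha> \<in> X \<alpha>) \<longrightarrow>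
        norm (\<Sum>\<alpha>\<in>F\<^sub>1. x \<alpha>) \<le> C * norm (\<Sum>\<alpha>\<in>F\<^sub>2. x \<alpha>))"

text \<open>The root spaces are taken as a family indexed by the point spectrum.\<close>

definition root_spaces_unconditional_basis :: "'a::chilbert_space set \<Rightarrow> ('a \<Rightarrow> 'a) \<Rightarrow> bool" where
  "root_spaces_unconditional_basis H A \<longleftrightarrow>
     unconditional_basis H (point_spectrum_on H A) (root_space_on H A)"

end

theory Submission
  imports Defs
begin

text \<open>
  On the space of square-summable sequences let \<open>T x = x \<circ> \<phi>\<close>, where \<open>\<phi>\<close> fixes the squares and
  advances every other index by one. Thus \<open>T\<close> is the direct sum of the finite blocks with
  indices \<open>d\<^sup>2 + 1, \<dots>, (d + 1)\<^sup>2\<close> (and of the one-dimensional block with index \<open>0\<close>). In the block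
  that ends at the square \<open>m\<close>, \<open>T\<close> is a backward shift on the coordinates before \<open>m\<close>, which
  gives the eigenvalue \<open>0\<close>, and the vector \<open>v\<close> with all coordinates of the block equal to \<open>1\<close> is
  an eigenvector for \<open>1\<close>. Both \<open>v\<close> and \<open>e\<^sub>m - v\<close> are root vectors of \<open>T\<close>, for \<open>1\<close> and \<open>0\<close>
  respectively. Their sum \<open>e\<^sub>m\<close> has norm \<open>1\<close>, whereas the norm of \<open>e\<^sub>m - v\<close> grows with the length
  of the block. So the root spaces of \<open>T\<close> are not an unconditional basis.

  The function \<open>f(z) = exp (2\<pi>\<i>z)\<close> has no critical points and takes the value \<open>1\<close> at both
  eigenvalues. Every unit vector is a sum of root vectors of \<open>T\<close> for \<open>0\<close> and \<open>1\<close>, and these are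
  root vectors of \<open>f(T)\<close> for \<open>1\<close>. The point spectrum of \<open>f(T)\<close> is \<open>{1}\<close> because \<open>f(T)\<close> acts on
  each block with the single eigenvalue \<open>1\<close>. Therefore \<open>f(T)\<close> has the single root space \<open>H\<close>,
  which is trivially an unconditional basis.

  As \<open>\<parallel>T\<parallel> \<le> 2\<close>, the set \<open>\<Omega>\<close> can be a disc about \<open>0\<close> of radius larger than \<open>2\<close>. In such a disc the
  Neumann series of the resolvent, integrated term by term over a circle, identifies \<open>f(T)\<close> with
  the Taylor series of \<open>f\<close> evaluated at \<open>T\<close> (\<open>riesz_dunford_ball\<close>), with which all further
  computations are made.
\<close>

section \<open>Complex multiples and complex subspaces\<close>

subclass (in chilbert_space) banach ..

lemma norm_scaleC: "norm (c *\<^sub>C x) = cmod c * norm (x::'a::complex_inner)"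
proof -
  have right: "cinner y (c *\<^sub>C x) = cnj c * cinner y x" for y
    by (subst cinner_commute, subst cinner_scaleC_left, subst cinner_commute) simp
  have "(norm (c *\<^sub>C x))\<^sup>2 = Re (c * cnj c * cinner x x)"
    unfolding power2_norm_eq_inner[of "c *\<^sub>C x"] Re_cinner[symmetric]
    by (simp add: cinner_scaleC_left right algebra_simps)
  also have "\<dots> = (cmod c * norm x)\<^sup>2"
    unfolding complex_norm_square[symmetric] power_mult_distrib power2_norm_eq_inner[of x]
    by (simp add: Re_cinner)
  finally show ?thesis
    by simp
qed

lemma bounded_linear_scaleC_left: "bounded_linear (\<lambda>c. c *\<^sub>C (x::'a::complex_inner))"
  by (rule bounded_linear_intro[where K = "norm x"])
     (simp_all add: scaleC_add_left scaleR_scaleC scaleC_scaleC scaleR_conv_of_real norm_scaleC)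

lemma bounded_linear_scaleC_right: "bounded_linear (\<lambda>x::'a::complex_inner. c *\<^sub>C x)"
  by (rule bounded_linear_intro[where K = "cmod c"])
     (simp_all add: scaleC_add_right scaleR_scaleC scaleC_scaleC norm_scaleC mult.commute)

lemma csubspaceI:
  assumes "0 \<in> V" "\<And>x y. x \<in> V \<Longrightarrow> y \<in> V \<Longrightarrow> x + y \<in> V" "\<And>c x. x \<in> V \<Longrightarrow> c *\<^sub>C x \<in> V"
  shows "csubspace V"
  using assms unfolding csubspace_def by blast

lemma
  assumes "csubspace V"
  shows csubspace_0: "0 \<in> V"
    and csubspace_add: "x \<in> V \<Longrightarrow> y \<in> V \<Longrightarrow> x + y \<in> V"
    and csubspace_scaleC: "x \<in> V \<Longrightarrow> c *\<^sub>C x \<in> V"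
  using assms unfolding csubspace_def by auto

lemma csubspace_sum:
  assumes "csubspace V" "\<And>i. i \<in> I \<Longrightarrow> x i \<in> V"
  shows "sum x I \<in> V"
  using assms(2)
  by (induction I rule: infinite_finite_induct) (auto simp: csubspace_0[OF assms(1)] csubspace_add[OF assms(1)])

lemma scaleC_diff_left: "(c - d) *\<^sub>C x = c *\<^sub>C x - d *\<^sub>C (x::'a::complex_inner)"
  by (rule linear_diff) (rule bounded_linear.linear[OF bounded_linear_scaleC_left])

lemma scaleC_diff_right: "c *\<^sub>C (x - y) = c *\<^sub>C x - c *\<^sub>C (y::'a::complex_inner)"
  by (rule linear_diff) (rule bounded_linear.linear[OF bounded_linear_scaleC_right])

lemma scaleC_zero_right: "c *\<^sub>C 0 = (0::'a::complex_inner)"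
  by (rule linear_0) (rule bounded_linear.linear[OF bounded_linear_scaleC_right])

section \<open>Power series of a bounded operator\<close>

lemma funpow_split: "j \<le> k \<Longrightarrow> (h ^^ k) x = (h ^^ (k - j)) ((h ^^ j) x)"
  by (metis funpow_add le_add_diff_inverse2 o_apply)

text \<open>The operator \<open>\<Sum>n. c\<^sub>n T\<^sup>n\<close>, where the sum is taken pointwise.\<close>

definition operator_series :: "(nat \<Rightarrow> complex) \<Rightarrow> ('a::chilbert_space \<Rightarrow> 'a) \<Rightarrow> 'a \<Rightarrow> 'a" where
  "operator_series c T x = (\<Sum>n. c n *\<^sub>C (T ^^ n) x)"

text \<open>
  A bounded complex-linear operator on the whole space, together with a bound \<open>K\<close> for its norm.
\<close>

locale bounded_operator =
  fixes T :: "'a::chilbert_space \<Rightarrow> 'a" and K :: real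
  assumes bounded_op: "bounded_op_on UNIV T"
    and K_nonneg: "0 \<le> K"
    and norm_le: "\<And>x. norm (T x) \<le> K * norm x"
begin

lemma T_add: "T (x + y) = T x + T y"
  and T_scaleC: "T (c *\<^sub>C x) = c *\<^sub>C T x"
  using bounded_op by (auto simp: bounded_op_on_def)

lemma bounded_linear_funpow: "bounded_linear (T ^^ n)"
  and norm_funpow_le: "norm ((T ^^ n) x) \<le> K ^ n * norm x"
  and funpow_scaleC: "(T ^^ n) (c *\<^sub>C x) = c *\<^sub>C (T ^^ n) x"
proof -
  have lin: "bounded_linear T"
    by (rule bounded_linear_intro[where K = K]) (auto simp: T_add T_scaleC scaleR_scaleC norm_le mult.commute)
  show "bounded_linear (T ^^ n)"
    by (induction n) (auto simp: o_def id_def intro: bounded_linear_compose[OF lin])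
  show "norm ((T ^^ n) x) \<le> K ^ n * norm x"
  proof (induction n)
    case (Suc n)
    have "norm ((T ^^ Suc n) x) \<le> K * norm ((T ^^ n) x)"
      using norm_le by simp
    also have "\<dots> \<le> K * (K ^ n * norm x)"
      using Suc K_nonneg by (rule mult_left_mono)
    finally show ?case by (simp add: mult.assoc)
  qed simp
  show "(T ^^ n) (c *\<^sub>C x) = c *\<^sub>C (T ^^ n) x"
    by (induction n) (simp_all add: T_scaleC)
qed

lemma bounded_linear_T: "bounded_linear T"
  using bounded_linear_funpow[of 1] by simp

lemma T_diff: "T (x - y) = T x - T y"
  by (rule linear_diff[OF bounded_linear.linear[OF bounded_linear_T]])

lemma T_zero: "T 0 = 0"
  by (rule linear_0[OF bounded_linear.linear[OF bounded_linear_T]])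

lemma norm_series_term_le: "norm (c n *\<^sub>C (T ^^ n) x) \<le> norm x * (cmod (c n) * K ^ n)"
  unfolding norm_scaleC using mult_left_mono[OF norm_funpow_le[of n x] norm_ge_zero[of "c n"]]
  by (simp add: mult_ac)

lemma series_sums:
  assumes "summable (\<lambda>n. cmod (c n) * K ^ n)"
  shows "(\<lambda>n. c n *\<^sub>C (T ^^ n) x) sums operator_series c T x"
  unfolding operator_series_def
  by (rule summable_sums[OF summable_comparison_test'[OF summable_mult[OF assms]]])
     (rule norm_series_term_le)

lemma series_scaleC:
  assumes "summable (\<lambda>n. cmod (c n) * K ^ n)"
  shows "operator_series c T (a *\<^sub>C x) = a *\<^sub>C operator_series c T x"
proof (rule sums_unique2[OF series_sums[OF assms]])
  show "(\<lambda>n. c n *\<^sub>C (T ^^ n) (a *\<^sub>C x)) sums (a *\<^sub>C operator_series c T x)"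
    using bounded_linear.sums[OF bounded_linear_scaleC_right series_sums[OF assms]]
    by (simp add: funpow_scaleC scaleC_scaleC mult.commute)
qed

lemma bounded_op_series:
  assumes "summable (\<lambda>n. cmod (c n) * K ^ n)"
  shows "bounded_op_on UNIV (operator_series c T)"
  unfolding bounded_op_on_def
proof (intro conjI ballI allI exI)
  fix x y
  show "operator_series c T (x + y) = operator_series c T x + operator_series c T y"
  proof (rule sums_unique2[OF series_sums[OF assms]])
    show "(\<lambda>n. c n *\<^sub>C (T ^^ n) (x + y)) sums (operator_series c T x + operator_series c T y)"
      using sums_add[OF series_sums[OF assms] series_sums[OF assms]]
      by (simp add: linear_add[OF bounded_linear.linear[OF bounded_linear_funpow]] scaleC_add_right)
  qed
next
  fix x
  have "norm (operator_series c T x) \<le> (\<Sum>n. norm x * (cmod (c n) * K ^ n))"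
    unfolding operator_series_def
    by (intro norm_suminf_le norm_series_term_le summable_mult assms)
  then show "norm (operator_series c T x) \<le> (\<Sum>n. cmod (c n) * K ^ n) * norm x"
    unfolding suminf_mult[OF assms] by (simp only: mult.commute)
qed (simp_all add: series_scaleC[OF assms])

lemma
  assumes "K < cmod z"
  shows summable_resolvent_coeffs: "summable (\<lambda>n. cmod (1 / z ^ Suc n) * K ^ n)"
    and is_resolvent_series: "is_resolvent UNIV T z (operator_series (\<lambda>n. 1 / z ^ Suc n) T)"
proof -
  let ?c = "\<lambda>n. 1 / z ^ Suc n"
  let ?R = "operator_series ?c T"
  have z: "z \<noteq> 0" using assms K_nonneg by auto
  have "summable (\<lambda>n. 1 / cmod z * (K / cmod z) ^ n)"
    using assms K_nonneg z by (intro summable_mult summable_geometric) simp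
  then show sc: "summable (\<lambda>n. cmod (?c n) * K ^ n)"
    by (simp add: norm_divide norm_power norm_mult power_divide)
  \<comment> \<open>The Neumann series is a left inverse by telescoping, and it commutes with \<open>T\<close>.\<close>
  have R1: "?R (z *\<^sub>C x - T x) = x" for x
  proof (rule sums_unique2[OF series_sums[OF sc]])
    let ?g = "\<lambda>n. (1 / z ^ n) *\<^sub>C (T ^^ n) x"
    have "(\<lambda>n. z *\<^sub>C (?c n *\<^sub>C (T ^^ n) x)) \<longlonglongrightarrow> z *\<^sub>C 0"
      by (intro bounded_linear.tendsto[OF bounded_linear_scaleC_right] summable_LIMSEQ_zero
          sums_summable[OF series_sums[OF sc]])
    then have "?g \<longlonglongrightarrow> 0"
      using z by (simp add: scaleC_scaleC scaleC_zero_right)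
    then have "(\<lambda>n. ?g n - ?g (Suc n)) sums (?g 0 - 0)"
      by (rule telescope_sums')
    moreover have "?g n - ?g (Suc n) = ?c n *\<^sub>C (T ^^ n) (z *\<^sub>C x - T x)" for n
      using z by (simp add: linear_diff[OF bounded_linear.linear[OF bounded_linear_funpow]]
          scaleC_diff_right funpow_scaleC scaleC_scaleC funpow_swap1)
    ultimately show "(\<lambda>n. ?c n *\<^sub>C (T ^^ n) (z *\<^sub>C x - T x)) sums x"
      by (simp add: scaleC_one)
  qed
  have RT: "?R (T x) = T (?R x)" for x
  proof (rule sums_unique2[OF series_sums[OF sc]])
    show "(\<lambda>n. ?c n *\<^sub>C (T ^^ n) (T x)) sums T (?R x)"
      using bounded_linear.sums[OF bounded_linear_T series_sums[OF sc, of x]]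
      by (simp add: T_scaleC funpow_swap1)
  qed
  have "?R (z *\<^sub>C x - T x) = z *\<^sub>C ?R x - T (?R x)" for x
  proof -
    have "?R (x + y) = ?R x + ?R y" for x y
      using bounded_op_series[OF sc] unfolding bounded_op_on_def by blast
    from this[of "z *\<^sub>C x - T x" "T x"]
    have "?R (z *\<^sub>C x) = ?R (z *\<^sub>C x - T x) + ?R (T x)" by simp
    then show ?thesis unfolding series_scaleC[OF sc] RT by simp
  qed
  then show "is_resolvent UNIV T z ?R"
    unfolding is_resolvent_def using R1 bounded_op_series[OF sc] by simp
qed

lemma resolvent_on_eq_series:
  assumes "K < cmod z"
  shows "resolvent_on UNIV T z x = operator_series (\<lambda>n. 1 / z ^ Suc n) T x"
proof -
  let ?R = "operator_series (\<lambda>n. 1 / z ^ Suc n) T"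
  have "is_resolvent UNIV T z (resolvent_on UNIV T z)"
    unfolding resolvent_on_def by (rule someI[of "is_resolvent UNIV T z"]) (rule is_resolvent_series[OF assms])
  then have "resolvent_on UNIV T z (z *\<^sub>C ?R x - T (?R x)) = ?R x"
    by (auto simp: is_resolvent_def)
  moreover have "z *\<^sub>C ?R x - T (?R x) = x"
    using is_resolvent_series[OF assms] by (auto simp: is_resolvent_def)
  ultimately show ?thesis by simp
qed

lemma spectrum_subset_cball: "spectrum_on UNIV T \<subseteq> cball 0 K"
proof
  fix z assume "z \<in> spectrum_on UNIV T"
  then have "\<not> K < cmod z"
    unfolding spectrum_on_def using is_resolvent_series by blast
  then show "z \<in> cball 0 K" by simp
qed

lemma taylor_coeffs_summable:
  assumes "f holomorphic_on ball 0 \<rho>" "K < \<rho>"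
  shows "summable (\<lambda>n. cmod ((deriv ^^ n) f 0 / fact n) * K ^ n)"
proof -
  obtain r where r: "K < r" "r < \<rho>" using dense[OF assms(2)] by blast
  have "summable (\<lambda>n. (deriv ^^ n) f 0 / fact n * (complex_of_real r) ^ n)"
    using holomorphic_power_series[OF assms(1), of "complex_of_real r"] r K_nonneg
    by (auto intro: sums_summable)
  then have "summable (\<lambda>n. norm ((deriv ^^ n) f 0 / fact n * (complex_of_real K) ^ n))"
    by (rule powser_insidea) (use r K_nonneg in simp)
  then show ?thesis
    using K_nonneg by (simp add: norm_mult norm_divide norm_power)
qed

section \<open>The functional calculus on a disc\<close>

text \<open>
  On the circle the Neumann series of the resolvent converges uniformly, and by Cauchy's formula
  for the derivatives the term with \<open>T\<^sup>n\<close> integrates to \<open>2\<pi>\<i>\<close> times a Taylor coefficient.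
\<close>

lemma circle_integral_resolvent:
  assumes f: "f holomorphic_on ball 0 \<rho>" and r: "K < r" "r < \<rho>"
  shows "vec_contour_integral (circlepath 0 r) (\<lambda>z. f z *\<^sub>C resolvent_on UNIV T z x)
       = (2 * of_real pi * \<i>) *\<^sub>C operator_series (\<lambda>n. (deriv ^^ n) f 0 / fact n) T x"
proof -
  let ?\<gamma> = "circlepath 0 r :: real \<Rightarrow> complex"
  let ?d = "\<lambda>t. vector_derivative ?\<gamma> (at t within {0..1})"
  let ?h = "\<lambda>n z. f z * (1 / z ^ Suc n)"
  let ?a = "\<lambda>n. (2 * of_real pi * \<i>) * ((deriv ^^ n) f 0 / fact n)"
  let ?F = "\<lambda>t. ?d t *\<^sub>C (f (?\<gamma> t) *\<^sub>C resolvent_on UNIV T (?\<gamma> t) x)"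
  define g where "g n t = (?h n (?\<gamma> t) * ?d t) *\<^sub>C (T ^^ n) x" for n t
  have r0: "0 < r" using r K_nonneg by linarith
  have norm_\<gamma>: "cmod (?\<gamma> t) = r" for t
    using r0 by (simp add: circlepath norm_mult)
  have cont_f: "continuous_on (cball 0 r) f"
    using r by (intro holomorphic_on_imp_continuous_on holomorphic_on_subset[OF f]) auto
  have hol_f: "f holomorphic_on ball 0 r"
    using r by (intro holomorphic_on_subset[OF f]) auto
  have norm_d: "cmod (?d t) = 2 * pi * r" if "t \<in> {0..1}" for t
    using that r0 by (simp add: vector_derivative_circlepath01 norm_mult)
  have cont_d: "continuous_on {0..1} ?d"
  proof (subst continuous_on_cong[OF refl vector_derivative_circlepath01])
    show "continuous_on {0..1} (\<lambda>t::real. 2 * pi * \<i> * r * exp (2 * of_real pi * \<i> * t))"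
      by (intro continuous_intros)
  qed auto
  have cont_\<gamma>: "continuous_on {0..1} ?\<gamma>"
    using path_circlepath[of 0 r] by (simp add: path_def)
  have cont_f\<gamma>: "continuous_on {0..1} (\<lambda>t. f (?\<gamma> t))"
    by (rule continuous_on_compose2[OF cont_f cont_\<gamma>]) (use norm_\<gamma> in auto)
  have cont_h: "continuous_on {0..1} (\<lambda>t. ?h n (?\<gamma> t) * ?d t)" for n
    using norm_\<gamma> r0 by (intro continuous_intros cont_f\<gamma> cont_\<gamma> cont_d) (metis norm_zero less_irrefl power_eq_0_iff)
  have cont_g: "continuous_on {0..1} (g n)" for n
    unfolding g_def by (rule bounded_linear.continuous_on[OF bounded_linear_scaleC_left cont_h])
  have int_g: "(g n has_integral (?a n *\<^sub>C (T ^^ n) x)) {0..1}" for n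
  proof -
    have "(?h n has_contour_integral ?a n) ?\<gamma>"
      using Cauchy_has_contour_integral_higher_derivative_circlepath[OF cont_f hol_f, of 0 n] r0
      by (simp add: field_simps)
    then show ?thesis
      unfolding g_def has_contour_integral_def
      by (rule has_integral_linear[OF _ bounded_linear_scaleC_left, unfolded o_def])
  qed
  obtain B where B: "\<And>z. z \<in> cball 0 r \<Longrightarrow> cmod (f z) \<le> B"
    using compact_imp_bounded[OF compact_continuous_image[OF cont_f compact_cball]]
    unfolding bounded_iff by blast
  have B0: "0 \<le> B" using order_trans[OF norm_ge_zero B[of 0]] r0 by simp
  have lim: "uniform_limit {0..1} (\<lambda>N t. \<Sum>n<N. g n t) (\<lambda>t. \<Sum>n. g n t) sequentially"
  proof (rule Weierstrass_m_test)
    fix n and t :: real assume t: "t \<in> {0..1}"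
    have "norm (g n t) = cmod (f (?\<gamma> t)) * (2 * pi * r / r ^ Suc n) * norm ((T ^^ n) x)"
      using t by (simp add: g_def norm_scaleC norm_mult norm_divide norm_power norm_\<gamma> norm_d)
    also have "\<dots> \<le> B * (2 * pi * r / r ^ Suc n) * (K ^ n * norm x)"
      using B0 r0 K_nonneg
      by (intro mult_mono B norm_funpow_le mult_nonneg_nonneg) (auto simp: norm_\<gamma>)
    also have "\<dots> = (B * 2 * pi * norm x) * (K / r) ^ n"
      using r0 by (simp add: power_divide)
    finally show "norm (g n t) \<le> (B * 2 * pi * norm x) * (K / r) ^ n" .
  next
    show "summable (\<lambda>n. (B * 2 * pi * norm x) * (K / r) ^ n)"
      using r r0 K_nonneg by (intro summable_mult summable_geometric) simp
  qed
  have F: "(\<Sum>n. g n t) = ?F t" for t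
  proof -
    have z: "K < cmod (?\<gamma> t)" using r norm_\<gamma> by simp
    have "(\<lambda>n. (?d t * f (?\<gamma> t)) *\<^sub>C ((1 / ?\<gamma> t ^ Suc n) *\<^sub>C (T ^^ n) x)) sums
        ((?d t * f (?\<gamma> t)) *\<^sub>C resolvent_on UNIV T (?\<gamma> t) x)"
      unfolding resolvent_on_eq_series[OF z]
      by (rule bounded_linear.sums[OF bounded_linear_scaleC_right series_sums[OF summable_resolvent_coeffs[OF z]]])
    then have "(\<lambda>n. g n t) sums ?F t"
      unfolding g_def by (simp add: scaleC_scaleC mult_ac)
    then show ?thesis by (rule sums_unique[symmetric])
  qed
  obtain I J where I: "\<And>N. ((\<lambda>t. \<Sum>n<N. g n t) has_integral I N) {0..1}"
    and J: "((\<lambda>t. \<Sum>n. g n t) has_integral J) {0..1}" and IJ: "I \<longlonglongrightarrow> J"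
    by (rule uniform_limit_integral[OF lim]) (auto intro!: continuous_on_sum cont_g)
  have "I = (\<lambda>N. \<Sum>n<N. ?a n *\<^sub>C (T ^^ n) x)"
    by (rule ext, rule has_integral_unique[OF I]) (intro has_integral_sum int_g finite_lessThan)
  then have "(\<lambda>n. ?a n *\<^sub>C (T ^^ n) x) sums J"
    using IJ unfolding sums_def by (simp only:)
  moreover have "(\<lambda>n. ?a n *\<^sub>C (T ^^ n) x) sums
      ((2 * of_real pi * \<i>) *\<^sub>C operator_series (\<lambda>n. (deriv ^^ n) f 0 / fact n) T x)"
    using bounded_linear.sums[OF bounded_linear_scaleC_right
        series_sums[OF taylor_coeffs_summable[OF f less_trans[OF r]]], of "2 * of_real pi * \<i>" x]
    by (simp add: scaleC_scaleC)
  ultimately have "J = (2 * of_real pi * \<i>) *\<^sub>C operator_series (\<lambda>n. (deriv ^^ n) f 0 / fact n) T x"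
    by (rule sums_unique2)
  with J show ?thesis
    unfolding vec_contour_integral_def F by (simp add: integral_unique)
qed

theorem riesz_dunford_ball:
  assumes f: "f holomorphic_on ball 0 \<rho>" and K: "K < \<rho>"
  shows "riesz_dunford UNIV T (ball 0 \<rho>) f (operator_series (\<lambda>n. (deriv ^^ n) f 0 / fact n) T)"
proof -
  obtain r where r: "K < r" "r < \<rho>" using dense[OF K] by blast
  then have r0: "0 < r" using K_nonneg by linarith
  have "surrounds_within [circlepath 0 r] (spectrum_on UNIV T) (ball 0 \<rho>)"
    unfolding surrounds_within_def
  proof (intro conjI ballI allI impI)
    fix z :: complex assume "z \<notin> ball 0 \<rho>"
    then have "winding_number (circlepath 0 r) z = 0"
      using r r0 by (intro winding_number_zero_outside[where s = "cball 0 r"]) auto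
    then show "(\<Sum>\<gamma>\<leftarrow>[circlepath 0 r]. winding_number \<gamma> z) = 0" by simp
  next
    fix z assume "z \<in> spectrum_on UNIV T"
    then have "z \<in> cball 0 K" using spectrum_subset_cball by blast
    then have "winding_number (circlepath 0 r) z = 1"
      using r by (intro winding_number_circlepath) auto
    then show "(\<Sum>\<gamma>\<leftarrow>[circlepath 0 r]. winding_number \<gamma> z) = 1" by simp
  qed (use r r0 spectrum_subset_cball in auto)
  then show ?thesis
    unfolding riesz_dunford_def
    using bounded_op_series[OF taylor_coeffs_summable[OF f K]]
    by (auto intro!: exI[of _ "[circlepath 0 r]"] simp: circle_integral_resolvent[OF f r] scaleC_scaleC scaleC_one)
qed

section \<open>Root vectors under the functional calculus\<close>

lemma bounded_operator_shift: "bounded_operator (\<lambda>y. T y - z *\<^sub>C y) (K + cmod z)"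
proof
  show bound: "norm (T x - z *\<^sub>C x) \<le> (K + cmod z) * norm x" for x
    using norm_triangle_ineq4[of "T x" "z *\<^sub>C x"] norm_le[of x] by (simp add: norm_scaleC distrib_right)
  show "bounded_op_on UNIV (\<lambda>y. T y - z *\<^sub>C y)"
    unfolding bounded_op_on_def
    by (intro conjI ballI allI exI[of _ "K + cmod z"])
       (simp_all add: bound T_add T_scaleC scaleC_add_right scaleC_diff_right scaleC_scaleC mult.commute[of z])
qed (simp add: K_nonneg)

lemma closed_kernel_funpow: "closed {x. (T ^^ j) x = 0}"
  using bounded_linear.continuous_on[OF bounded_linear_funpow continuous_on_id]
  by (intro closed_Collect_eq) auto

lemma csubspace_kernel_funpow: "csubspace {x. (T ^^ j) x = 0}"
  by (rule csubspaceI)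
     (auto simp: linear_0 linear_add bounded_linear.linear[OF bounded_linear_funpow] funpow_scaleC scaleC_zero_right)

end

text \<open>The union of the kernels of the powers of \<open>A - z\<close>; its closure is the root space of \<open>A\<close> at \<open>z\<close>.\<close>

definition root_vectors :: "('a::chilbert_space \<Rightarrow> 'a) \<Rightarrow> complex \<Rightarrow> 'a set" where
  "root_vectors A z = (\<Union>j\<in>{1..}. {x. ((\<lambda>y. A y - z *\<^sub>C y) ^^ j) x = 0})"

lemma root_space_eq_closure: "root_space_on UNIV A z = closure (root_vectors A z)"
  by (simp add: root_space_on_def root_vectors_def)

context bounded_operator
begin

lemma root_vectorsI:
  assumes "((\<lambda>y. T y - z *\<^sub>C y) ^^ j) x = 0"
  shows "x \<in> root_vectors T z"
proof -
  interpret D: bounded_operator "\<lambda>y. T y - z *\<^sub>C y" "K + cmod z"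
    by (rule bounded_operator_shift)
  have "((\<lambda>y. T y - z *\<^sub>C y) ^^ Suc j) x = 0"
    using assms by (simp add: D.T_zero[simplified])
  then show ?thesis
    unfolding root_vectors_def by (intro UN_I[of "Suc j"]) auto
qed

lemma csubspace_root_vectors: "csubspace (root_vectors T z)"
proof -
  let ?D = "\<lambda>y. T y - z *\<^sub>C y"
  interpret D: bounded_operator ?D "K + cmod z"
    by (rule bounded_operator_shift)
  have zero: "(?D ^^ j) 0 = 0" for j
    using csubspace_0[OF D.csubspace_kernel_funpow[of j]] by simp
  have mono: "(?D ^^ k) x = 0" if "(?D ^^ j) x = 0" "j \<le> k" for x j k
  proof -
    have "(?D ^^ k) x = (?D ^^ (k - j)) ((?D ^^ j) x)"
      by (rule funpow_split[OF that(2)])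
    then show ?thesis using that(1) zero by simp
  qed
  show ?thesis
  proof (rule csubspaceI)
    show "0 \<in> root_vectors T z"
      by (rule root_vectorsI[where j = 0]) simp
  next
    fix x y assume "x \<in> root_vectors T z" "y \<in> root_vectors T z"
    then obtain j k where "(?D ^^ j) x = 0" "(?D ^^ k) y = 0"
      by (auto simp: root_vectors_def)
    then have "(?D ^^ max j k) x = 0" "(?D ^^ max j k) y = 0"
      by (auto intro: mono)
    then show "x + y \<in> root_vectors T z"
      using csubspace_add[OF D.csubspace_kernel_funpow[of "max j k"], of x y]
      by (intro root_vectorsI[where j = "max j k"]) simp
  next
    fix c x assume "x \<in> root_vectors T z"
    then obtain j where "(?D ^^ j) x = 0"
      by (auto simp: root_vectors_def)
    then show "c *\<^sub>C x \<in> root_vectors T z"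
      by (intro root_vectorsI[where j = j]) (simp add: D.funpow_scaleC scaleC_zero_right)
  qed
qed

text \<open>
  The functional calculus maps root vectors for \<open>z\<close> to root vectors for \<open>f z\<close>: on the kernel of
  \<open>(T - z)\<^bsup>j+1\<^esup>\<close> the operators \<open>T\<^sup>n\<close> and \<open>z\<^sup>n\<close> agree modulo the kernel of \<open>(T - z)\<^sup>j\<close>, which is
  closed. Hence \<open>f(T) - f z\<close> lowers the index \<open>j\<close> of such a kernel.
\<close>

lemma root_vectors_series:
  assumes f: "f holomorphic_on ball 0 \<rho>" and K: "K < \<rho>" and z: "cmod z < \<rho>"
  defines "E \<equiv> operator_series (\<lambda>n. (deriv ^^ n) f 0 / fact n) T"
  shows "root_vectors T z \<subseteq> root_vectors E (f z)"
proof
  let ?D = "\<lambda>y. T y - z *\<^sub>C y"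
  let ?G = "\<lambda>y. E y - f z *\<^sub>C y"
  let ?c = "\<lambda>n. (deriv ^^ n) f 0 / fact n"
  interpret D: bounded_operator ?D "K + cmod z"
    by (rule bounded_operator_shift)
  have step: "(?D ^^ j) (?G v) = 0" if v: "(?D ^^ Suc j) v = 0" for j v
  proof -
    let ?V = "{x. (?D ^^ j) x = 0}"
    note V = D.csubspace_kernel_funpow[of j]
    have Dv: "?D v \<in> ?V"
      using v by (simp only: funpow_Suc_right o_apply mem_Collect_eq)
    have inv: "T x \<in> ?V" if "x \<in> ?V" for x
    proof -
      have "(?D ^^ j) (?D x) = ?D ((?D ^^ j) x)" by (rule funpow_swap1[symmetric])
      then have "?D x \<in> ?V" using that by (simp add: T_zero scaleC_zero_right)
      from csubspace_add[OF V this csubspace_scaleC[OF V that, of z]] show ?thesis by simp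
    qed
    have "(T ^^ n) v - (z ^ n) *\<^sub>C v \<in> ?V" for n
    proof (induction n)
      case 0
      then show ?case using csubspace_0[OF V] by (simp add: scaleC_one)
    next
      case (Suc n)
      have "(T ^^ Suc n) v - (z ^ Suc n) *\<^sub>C v
          = T ((T ^^ n) v - (z ^ n) *\<^sub>C v) + (z ^ n) *\<^sub>C ?D v"
        by (simp add: T_diff T_scaleC scaleC_diff_right scaleC_scaleC mult.commute)
      then show ?case
        using csubspace_add[OF V inv[OF Suc] csubspace_scaleC[OF V Dv, of "z ^ n"]] by simp
    qed
    then have "?c n *\<^sub>C ((T ^^ n) v - (z ^ n) *\<^sub>C v) \<in> ?V" for n
      by (rule csubspace_scaleC[OF V])
    then have in_V: "(\<Sum>n<N. ?c n *\<^sub>C ((T ^^ n) v - (z ^ n) *\<^sub>C v)) \<in> ?V" for N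
      by (rule csubspace_sum[OF V])
    have "(\<lambda>n. ?c n * z ^ n) sums f z"
      using holomorphic_power_series[OF f, of z] z by simp
    from sums_diff[OF series_sums[OF taylor_coeffs_summable[OF f K], of v]
        bounded_linear.sums[OF bounded_linear_scaleC_left this, of v]]
    have "(\<lambda>n. ?c n *\<^sub>C ((T ^^ n) v - (z ^ n) *\<^sub>C v)) sums ?G v"
      by (simp add: E_def scaleC_diff_right scaleC_scaleC)
    then have "?G v \<in> ?V"
      unfolding sums_def by (rule closed_sequentially[OF D.closed_kernel_funpow in_V])
    then show ?thesis by simp
  qed
  have "(?G ^^ j) v = 0" if "(?D ^^ j) v = 0" for j v
    using that
  proof (induction j arbitrary: v)
    case (Suc j)
    from Suc.IH[OF step[OF Suc.prems]] show ?case by (simp only: funpow_Suc_right o_apply)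
  qed simp
  then show "x \<in> root_vectors E (f z)" if "x \<in> root_vectors T z" for x
    using that unfolding root_vectors_def by auto
qed

end

lemma bounded_op_imp_bounded_operator:
  assumes "bounded_op_on UNIV A"
  shows "\<exists>K. bounded_operator A K"
proof -
  obtain K where K: "\<And>x. norm (A x) \<le> K * norm x"
    using assms unfolding bounded_op_on_def by auto
  have "norm (A x) \<le> max K 0 * norm x" for x
    using K[of x] mult_right_mono[of K "max K 0" "norm x"] by simp
  then show ?thesis
    using assms by (intro exI[of _ "max K 0"] bounded_operator.intro) auto
qed

lemma unconditional_basis_single_root_space:
  assumes "point_spectrum_on UNIV A = {z}" "root_space_on UNIV A z = UNIV"
  shows "root_spaces_unconditional_basis UNIV A"
  unfolding root_spaces_unconditional_basis_def unconditional_basis_def assms(1)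
proof (intro conjI)
  show "\<forall>\<alpha>\<in>{z}. csubspace (root_space_on UNIV A \<alpha>) \<and> root_space_on UNIV A \<alpha> \<subseteq> UNIV"
    by (simp add: assms(2) csubspace_def)
  have single: "F = {} \<or> F = {z}" if "F \<subseteq> {z}" for F
    using that by blast
  show "lin_indep_subspaces {z} (root_space_on UNIV A)"
    unfolding lin_indep_subspaces_def
  proof (intro allI impI ballI)
    fix F :: "complex set" and x :: "complex \<Rightarrow> 'a" and \<alpha>
    assume "finite F \<and> F \<subseteq> {z} \<and> (\<forall>\<alpha>\<in>F. x \<alpha> \<in> root_space_on UNIV A \<alpha>) \<and> (\<Sum>\<alpha>\<in>F. x \<alpha>) = 0"
      and "\<alpha> \<in> F"
    moreover from this have "F = {\<alpha>}" by blast
    ultimately show "x \<alpha> = 0" by auto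
  qed
  have "x \<in> span_subspaces {z} (root_space_on UNIV A)" for x
    unfolding span_subspaces_def mem_Collect_eq
    by (intro exI[of _ "{z}"] exI[of _ "\<lambda>_. x"]) (simp add: assms(2))
  then show "UNIV \<subseteq> closure (span_subspaces {z} (root_space_on UNIV A))"
    using closure_subset by blast
  show "\<exists>C>0. \<forall>F\<^sub>1 F\<^sub>2 x. finite F\<^sub>2 \<and> F\<^sub>1 \<subseteq> F\<^sub>2 \<and> F\<^sub>2 \<subseteq> {z} \<and> (\<forall>\<alpha>\<in>F\<^sub>2. x \<alpha> \<in> root_space_on UNIV A \<alpha>) \<longrightarrow>
      norm (\<Sum>\<alpha>\<in>F\<^sub>1. x \<alpha>) \<le> C * norm (\<Sum>\<alpha>\<in>F\<^sub>2. x \<alpha>)"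
  proof (intro exI[of _ 1] conjI allI impI)
    fix F\<^sub>1 F\<^sub>2 :: "complex set" and x :: "complex \<Rightarrow> 'a"
    assume F: "finite F\<^sub>2 \<and> F\<^sub>1 \<subseteq> F\<^sub>2 \<and> F\<^sub>2 \<subseteq> {z} \<and> (\<forall>\<alpha>\<in>F\<^sub>2. x \<alpha> \<in> root_space_on UNIV A \<alpha>)"
    then have "F\<^sub>1 = {} \<or> F\<^sub>1 = F\<^sub>2" using single by blast
    then show "norm (\<Sum>\<alpha>\<in>F\<^sub>1. x \<alpha>) \<le> 1 * norm (\<Sum>\<alpha>\<in>F\<^sub>2. x \<alpha>)" by auto
  qed simp
qed simp

section \<open>Unit vectors and separability of the sequence space\<close>

lift_definition unit_vec :: "nat \<Rightarrow> ell2" is "\<lambda>k n. if n = k then 1 else 0"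
proof -
  fix k :: nat
  show "summable (\<lambda>n. (cmod (if n = k then 1 else 0))\<^sup>2)"
    by (rule summable_finite[of "{k}"]) auto
qed

lemma ell2_nth_sum: "ell2_nth (sum x I) n = (\<Sum>i\<in>I. ell2_nth (x i) n)"
  by (induction I rule: infinite_finite_induct) (simp_all add: zero_ell2.rep_eq plus_ell2.rep_eq)

lemma norm_unit_vec: "norm (unit_vec k) = 1"
proof -
  have "(norm (unit_vec k))\<^sup>2 = (\<Sum>n\<in>{k}. (cmod (ell2_nth (unit_vec k) n))\<^sup>2)"
    unfolding ell2_norm_sq by (rule suminf_finite) (auto simp: unit_vec.rep_eq)
  then have "(norm (unit_vec k))\<^sup>2 = 1" by (simp add: unit_vec.rep_eq)
  then show ?thesis using norm_ge_zero[of "unit_vec k"] by (simp add: power2_eq_1_iff)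
qed

lemma unit_vec_expansion: "(\<lambda>k. ell2_nth x k *\<^sub>C unit_vec k) sums x"
proof -
  let ?g = "\<lambda>k. (cmod (ell2_nth x k))\<^sup>2"
  let ?s = "\<lambda>N. \<Sum>k<N. ell2_nth x k *\<^sub>C unit_vec k"
  have "(norm (x - ?s N))\<^sup>2 = (norm x)\<^sup>2 - (\<Sum>k<N. ?g k)" for N
  proof -
    let ?h = "\<lambda>n. (cmod (ell2_nth (x - ?s N) n))\<^sup>2"
    have nth: "ell2_nth (x - ?s N) n = (if n < N then 0 else ell2_nth x n)" for n
      by (simp add: minus_ell2.rep_eq ell2_nth_sum scaleC_ell2.rep_eq unit_vec.rep_eq if_distrib[of "(*) _"] cong: if_cong)
    have "(norm (x - ?s N))\<^sup>2 = (\<Sum>n. ?h (n + N)) + (\<Sum>n<N. ?h n)"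
      unfolding ell2_norm_sq[of "x - ?s N"] by (rule suminf_split_initial_segment[OF ell2_summable])
    also have "\<dots> = (\<Sum>n. ?g (n + N))"
      by (simp add: nth)
    also have "\<dots> = (norm x)\<^sup>2 - (\<Sum>k<N. ?g k)"
      unfolding ell2_norm_sq by (rule suminf_minus_initial_segment[OF ell2_summable])
    finally show ?thesis .
  qed
  moreover have "(\<lambda>N. (norm x)\<^sup>2 - (\<Sum>k<N. ?g k)) \<longlonglongrightarrow> (norm x)\<^sup>2 - (norm x)\<^sup>2"
    unfolding ell2_norm_sq by (intro tendsto_diff tendsto_const summable_LIMSEQ ell2_summable)
  ultimately have "(\<lambda>N. (norm (x - ?s N))\<^sup>2) \<longlonglongrightarrow> 0" by simp
  then have "(\<lambda>N. norm (x - ?s N)) \<longlonglongrightarrow> 0"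
    using tendsto_real_sqrt by fastforce
  then have "(\<lambda>N. norm (?s N - x)) \<longlonglongrightarrow> 0"
    by (simp add: norm_minus_commute)
  then show ?thesis
    unfolding sums_def by (simp add: tendsto_norm_zero_iff LIM_zero_iff)
qed

lemma closure_eq_UNIV_if_unit_vecs:
  assumes "csubspace V" "\<And>k. unit_vec k \<in> V"
  shows "closure V = UNIV"
proof -
  have "x \<in> closure V" for x
    unfolding closure_sequential
  proof (intro exI conjI allI)
    show "(\<Sum>k<N. ell2_nth x k *\<^sub>C unit_vec k) \<in> V" for N
      by (intro csubspace_sum csubspace_scaleC assms)
    show "(\<lambda>N. \<Sum>k<N. ell2_nth x k *\<^sub>C unit_vec k) \<longlonglongrightarrow> x"
      using unit_vec_expansion unfolding sums_def .
  qed
  then show ?thesis by blast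
qed

lemma separable_hilbert_UNIV: "separable_hilbert (UNIV :: ell2 set)"
proof -
  obtain Q :: "complex set" where Q: "countable Q"
    and Q_dense: "\<And>X. open X \<Longrightarrow> X \<noteq> {} \<Longrightarrow> \<exists>d\<in>Q. d \<in> X"
    using countable_dense_exists by blast
  \<comment> \<open>A countable dense set is given by the finite sequences with entries in \<open>Q\<close>.\<close>
  define D where "D = (\<lambda>l. \<Sum>k<length l. (l ! k) *\<^sub>C unit_vec k) ` lists Q"
  have partial: "(\<Sum>k<N. a k *\<^sub>C unit_vec k) \<in> closure D" for a N
    unfolding closure_approachable
  proof (intro allI impI)
    fix e :: real assume e: "0 < e"
    have "\<exists>d\<in>Q. d \<in> ball (a k) (e / Suc N)" for k
    proof (rule Q_dense)
      have "0 < e / Suc N" using e by simp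
      then show "ball (a k) (e / Suc N) \<noteq> {}" by (metis centre_in_ball empty_iff)
    qed simp
    then obtain d where d: "\<And>k. d k \<in> Q" "\<And>k. d k \<in> ball (a k) (e / Suc N)"
      by metis
    let ?y = "\<Sum>k<N. d k *\<^sub>C unit_vec k"
    have "?y = (\<lambda>l. \<Sum>k<length l. (l ! k) *\<^sub>C unit_vec k) (map d [0..<N])"
      by simp
    then have "?y \<in> D"
      unfolding D_def by (rule image_eqI) (use d in auto)
    moreover have "dist ?y (\<Sum>k<N. a k *\<^sub>C unit_vec k) < e"
    proof -
      have "norm (?y - (\<Sum>k<N. a k *\<^sub>C unit_vec k)) = norm (\<Sum>k<N. (d k - a k) *\<^sub>C unit_vec k)"
        by (simp add: sum_subtractf scaleC_diff_left)
      also have "\<dots> \<le> (\<Sum>k<N. e / Suc N)"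
        using d(2) by (intro sum_norm_le) (simp add: norm_scaleC norm_unit_vec dist_norm norm_minus_commute less_imp_le)
      also have "\<dots> < e"
        using e by (simp add: field_simps)
      finally show ?thesis by (simp add: dist_norm)
    qed
    ultimately show "\<exists>y\<in>D. dist y (\<Sum>k<N. a k *\<^sub>C unit_vec k) < e" by blast
  qed
  have "x \<in> closure D" for x
    using unit_vec_expansion[of x] unfolding sums_def
    by (rule closed_sequentially[OF closed_closure partial])
  moreover have "countable D"
    unfolding D_def by (intro countable_image countable_lists Q)
  ultimately show ?thesis
    unfolding separable_hilbert_def csubspace_def by auto
qed

section \<open>The operator and its root vectors\<close>

definition is_sq :: "nat \<Rightarrow> bool" where
  "is_sq n \<longleftrightarrow> (\<exists>k. n = k * k)"

lemma is_sq_mult [simp]: "is_sq (k * k)"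
  by (auto simp: is_sq_def)

lemma is_sq_0 [simp]: "is_sq 0"
  using is_sq_mult[of 0] by simp

text \<open>The index map \<open>\<phi>\<close>: it stops at the squares and advances by one elsewhere.\<close>

definition advance :: "nat \<Rightarrow> nat" where
  "advance n = (if is_sq n then n else Suc n)"

lemma advance_funpow_sq: "is_sq n \<Longrightarrow> (advance ^^ j) n = n"
  by (induction j) (auto simp: advance_def)

lemma advance_funpow_cases: "(advance ^^ j) n = n + j \<or> is_sq ((advance ^^ j) n)"
  by (induction j) (auto simp: advance_def)

lemma advance_funpow_nonsq:
  "(\<And>i. i < j \<Longrightarrow> \<not> is_sq (n + i)) \<Longrightarrow> (advance ^^ j) n = n + j"
  by (induction j) (auto simp: advance_def)

lemma advance_reaches_sq: "\<exists>j. is_sq ((advance ^^ j) n)"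
proof (rule ccontr)
  assume none: "\<nexists>j. is_sq ((advance ^^ j) n)"
  then have "(advance ^^ (n * n - n)) n = n + (n * n - n)"
    using advance_funpow_cases by blast
  also have "\<dots> = n * n" by simp
  finally show False using none by (metis is_sq_def)
qed

text \<open>The composition operator \<open>T x = x \<circ> \<phi>\<close>.\<close>

lift_definition comp_op :: "ell2 \<Rightarrow> ell2" is "\<lambda>x n. x (advance n)"
proof -
  fix x :: "nat \<Rightarrow> complex" assume x: "summable (\<lambda>n. (cmod (x n))\<^sup>2)"
  show "summable (\<lambda>n. (cmod (x (advance n)))\<^sup>2)"
  proof (rule summable_comparison_test')
    show "summable (\<lambda>n. (cmod (x n))\<^sup>2 + (cmod (x (Suc n)))\<^sup>2)"
      using x by (intro summable_add) (simp_all add: summable_Suc_iff[where f = "\<lambda>n. (cmod (x n))\<^sup>2"])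
    show "norm ((cmod (x (advance n)))\<^sup>2) \<le> (cmod (x n))\<^sup>2 + (cmod (x (Suc n)))\<^sup>2" for n
      by (simp add: advance_def)
  qed
qed

lemma ell2_nth_comp_op_funpow: "ell2_nth ((comp_op ^^ j) x) n = ell2_nth x ((advance ^^ j) n)"
  by (induction j arbitrary: n) (simp_all add: comp_op.rep_eq del: funpow.simps(2) add: funpow.simps(2)[of _ comp_op] funpow_Suc_right[of _ advance])

lemma norm_comp_op_le: "norm (comp_op x) \<le> 2 * norm x"
proof (rule power2_le_imp_le)
  let ?g = "\<lambda>n. (cmod (ell2_nth x n))\<^sup>2"
  have s: "summable (\<lambda>n. ?g (Suc n))"
    using ell2_summable by (subst summable_Suc_iff)
  have "(norm (comp_op x))\<^sup>2 \<le> (\<Sum>n. ?g n + ?g (Suc n))"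
    unfolding ell2_norm_sq[of "comp_op x"]
    by (intro suminf_le summable_add ell2_summable s) (simp add: comp_op.rep_eq advance_def)
  also have "\<dots> = (norm x)\<^sup>2 + ((norm x)\<^sup>2 - ?g 0)"
    unfolding ell2_norm_sq suminf_add[OF ell2_summable s, symmetric]
    using suminf_split_head[OF ell2_summable[of x]] by simp
  also have "\<dots> \<le> 2 * (norm x)\<^sup>2"
    by simp
  also have "\<dots> \<le> (2 * norm x)\<^sup>2"
    by (simp add: power_mult_distrib)
  finally show "(norm (comp_op x))\<^sup>2 \<le> (2 * norm x)\<^sup>2" .
qed simp

interpretation comp_op: bounded_operator comp_op 2
proof
  show "bounded_op_on UNIV comp_op"
    unfolding bounded_op_on_def
    by (auto intro!: norm_comp_op_le ell2_eqI simp: comp_op.rep_eq plus_ell2.rep_eq scaleC_ell2.rep_eq)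
qed (simp_all add: norm_comp_op_le)

text \<open>Rewrites \<open>(A - 0)\<^sup>j\<close> in the definition of root vectors to \<open>A\<^sup>j\<close>.\<close>

lemma shift_zero: "(\<lambda>y. A y - 0 *\<^sub>C y) = (A :: 'a::complex_inner \<Rightarrow> 'a)"
  using scaleC_diff_left[of 0 0] by (intro ext) simp

lemma comp_op_funpow_unit_vec_nonsq:
  assumes "\<not> is_sq k"
  shows "(comp_op ^^ Suc k) (unit_vec k) = 0"
proof (rule ell2_eqI)
  fix n
  have "(advance ^^ Suc k) n \<noteq> k"
    using advance_funpow_cases[of "Suc k" n] assms by (auto simp del: funpow.simps)
  then show "ell2_nth ((comp_op ^^ Suc k) (unit_vec k)) n = ell2_nth 0 n"
    by (simp add: ell2_nth_comp_op_funpow unit_vec.rep_eq zero_ell2.rep_eq del: funpow.simps)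
qed

text \<open>
  For a square \<open>m\<close> this is the sum of the unit vectors in the block that ends at \<open>m\<close>: the
  coordinate at \<open>n\<close> is \<open>1\<close> if and only if \<open>\<phi>\<^sup>m n = m\<close>, and \<open>m\<close> steps suffice to reach \<open>m\<close> from
  any index of its block.
\<close>

definition block_vec :: "nat \<Rightarrow> ell2" where
  "block_vec m = (comp_op ^^ m) (unit_vec m)"

lemma comp_op_block_vec:
  assumes "is_sq m"
  shows "comp_op (block_vec m) = block_vec m"
proof (rule ell2_eqI)
  fix n
  have "(advance ^^ Suc m) n = m \<longleftrightarrow> (advance ^^ m) n = m"
    using advance_funpow_cases[of m n] assms by (auto simp: advance_def)
  then have "ell2_nth ((comp_op ^^ Suc m) (unit_vec m)) n = ell2_nth ((comp_op ^^ m) (unit_vec m)) n"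
    unfolding ell2_nth_comp_op_funpow by (simp add: unit_vec.rep_eq del: funpow.simps)
  then show "ell2_nth (comp_op (block_vec m)) n = ell2_nth (block_vec m) n"
    by (simp add: block_vec_def)
qed

lemma block_vec_root_vector:
  assumes "is_sq m"
  shows "block_vec m \<in> root_vectors comp_op 1"
  by (rule comp_op.root_vectorsI[where j = 1]) (simp add: comp_op_block_vec[OF assms] scaleC_one)

lemma unit_vec_minus_block_vec_root_vector:
  assumes "is_sq m"
  shows "unit_vec m - block_vec m \<in> root_vectors comp_op 0"
proof (rule comp_op.root_vectorsI[where j = m])
  \<comment> \<open>The vectors \<open>e\<^sub>m\<close> and \<open>v = T\<^sup>m e\<^sub>m\<close> have the same image \<open>v\<close> under \<open>T\<^sup>m\<close>.\<close>
  have "(comp_op ^^ j) (block_vec m) = block_vec m" for j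
    by (induction j) (simp_all add: comp_op_block_vec[OF assms])
  then show "((\<lambda>y. comp_op y - 0 *\<^sub>C y) ^^ m) (unit_vec m - block_vec m) = 0"
    by (simp add: shift_zero linear_diff[OF bounded_linear.linear[OF comp_op.bounded_linear_funpow]]
        flip: block_vec_def)
qed

lemma norm_unit_vec_minus_block_vec:
  assumes "m = Suc d * Suc d"
  shows "real d \<le> (norm (unit_vec m - block_vec m))\<^sup>2"
proof -
  let ?u = "unit_vec m - block_vec m"
  have m: "is_sq m" unfolding assms by (rule is_sq_mult)
  have dm: "d * d + d < m" using assms by simp
  have "ell2_nth ?u n = -1" if n: "n \<in> {m - d..<m}" for n
  proof -
    \<comment> \<open>There is no square strictly between \<open>d\<^sup>2\<close> and \<open>(d + 1)\<^sup>2\<close>.\<close>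
    have "\<not> is_sq (n + i)" if "i < m - n" for i
    proof
      assume "is_sq (n + i)"
      then obtain k where k: "n + i = k * k" by (auto simp: is_sq_def)
      have "d * d < k * k" "k * k < Suc d * Suc d"
        using n that k assms dm by auto
      then have "d < k" "k < Suc d"
        by (meson mult_le_mono not_le)+
      then show False by simp
    qed
    then have "(advance ^^ (m - n)) n = m"
      using advance_funpow_nonsq[of "m - n" n] n by simp
    moreover have "(advance ^^ m) n = (advance ^^ n) ((advance ^^ (m - n)) n)"
      using n funpow_split[of "m - n" m advance n] by simp
    ultimately have "(advance ^^ m) n = m"
      by (simp add: advance_funpow_sq[OF m])
    then show ?thesis
      using n by (simp add: minus_ell2.rep_eq block_vec_def ell2_nth_comp_op_funpow unit_vec.rep_eq)
  qed
  then have "(\<Sum>n\<in>{m - d..<m}. (cmod (ell2_nth ?u n))\<^sup>2) = real d"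
    using dm by simp
  moreover have "(\<Sum>n\<in>{m - d..<m}. (cmod (ell2_nth ?u n))\<^sup>2) \<le> (\<Sum>n<m. (cmod (ell2_nth ?u n))\<^sup>2)"
    by (intro sum_mono2) auto
  ultimately show ?thesis
    using ell2_partial_le[of ?u m] by linarith
qed

section \<open>The root spaces of the operator are not a basis\<close>

lemma comp_op_root_spaces_not_basis: "\<not> root_spaces_unconditional_basis UNIV comp_op"
proof
  let ?R = "root_space_on UNIV comp_op"
  let ?P = "point_spectrum_on UNIV comp_op"
  assume "root_spaces_unconditional_basis UNIV comp_op"
  then obtain C where C: "\<forall>F\<^sub>1 F\<^sub>2 x. finite F\<^sub>2 \<and> F\<^sub>1 \<subseteq> F\<^sub>2 \<and> F\<^sub>2 \<subseteq> ?P \<and> (\<forall>\<alpha>\<in>F\<^sub>2. x \<alpha> \<in> ?R \<alpha>) \<longrightarrow>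
      norm (\<Sum>\<alpha>\<in>F\<^sub>1. x \<alpha>) \<le> C * norm (\<Sum>\<alpha>\<in>F\<^sub>2. x \<alpha>)"
    unfolding root_spaces_unconditional_basis_def unconditional_basis_def by (elim conjE exE)
  have nz: "unit_vec k \<noteq> 0" for k
    using norm_unit_vec[of k] by auto
  have sq1: "is_sq 1"
    using is_sq_mult[of 1] by simp
  have nsq2: "\<not> is_sq 2"
  proof
    assume "is_sq 2"
    then obtain k :: nat where k: "2 = k * k" unfolding is_sq_def by blast
    then have "k \<noteq> 0" "k \<noteq> 1" by (metis mult_0 zero_neq_numeral, metis mult_1 numeral_eq_one_iff semiring_norm(85))
    then have "2 * 2 \<le> k * k" by (intro mult_le_mono) auto
    with k show False by simp
  qed
  \<comment> \<open>Both \<open>1\<close> and \<open>0\<close> are eigenvalues: index \<open>0\<close> forms a block of its own, and index \<open>2\<close> is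
    the first one of the block \<open>2, 3, 4\<close>.\<close>
  have "comp_op (unit_vec 0) = 1 *\<^sub>C unit_vec 0"
    using comp_op_block_vec[OF is_sq_0] by (simp add: block_vec_def scaleC_one)
  then have P1: "1 \<in> ?P"
    unfolding point_spectrum_on_def using nz by blast
  have "comp_op (unit_vec 2) = 0 *\<^sub>C unit_vec 2"
  proof (rule ell2_eqI)
    fix n
    have "advance n \<noteq> 2"
      using sq1 nsq2 by (auto simp: advance_def numeral_2_eq_2)
    then show "ell2_nth (comp_op (unit_vec 2)) n = ell2_nth (0 *\<^sub>C unit_vec 2) n"
      by (simp add: comp_op.rep_eq unit_vec.rep_eq scaleC_ell2.rep_eq)
  qed
  then have P0: "0 \<in> ?P"
    unfolding point_spectrum_on_def using nz by blast
  \<comment> \<open>The basis inequality for \<open>e\<^sub>m = (e\<^sub>m - v) + v\<close>, with \<open>m\<close> the square \<open>(d + 1)\<^sup>2\<close>.\<close>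
  have bound: "real d \<le> C\<^sup>2" for d
  proof -
    define m where "m = Suc d * Suc d"
    have m: "is_sq m" unfolding m_def by (rule is_sq_mult)
    let ?x = "\<lambda>\<alpha>. if \<alpha> = (0::complex) then unit_vec m - block_vec m else block_vec m"
    have "norm (\<Sum>\<alpha>\<in>{0}. ?x \<alpha>) \<le> C * norm (\<Sum>\<alpha>\<in>{0, 1}. ?x \<alpha>)"
    proof (intro C[rule_format] conjI ballI)
      fix \<alpha> :: complex assume "\<alpha> \<in> {0, 1}"
      then show "?x \<alpha> \<in> ?R \<alpha>"
        using block_vec_root_vector[OF m] unit_vec_minus_block_vec_root_vector[OF m]
          closure_subset[of "root_vectors comp_op 0"] closure_subset[of "root_vectors comp_op 1"]
        by (auto simp: root_space_eq_closure)
    qed (use P0 P1 in auto)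
    then have "norm (unit_vec m - block_vec m) \<le> C"
      by (simp add: norm_unit_vec)
    then have "(norm (unit_vec m - block_vec m))\<^sup>2 \<le> C\<^sup>2"
      by (intro power_mono) auto
    then show ?thesis
      using norm_unit_vec_minus_block_vec[OF m_def] by linarith
  qed
  show False
    using reals_Archimedean2[of "C\<^sup>2"] bound by (meson not_le)
qed

section \<open>Functions of the operator with a single root space\<close>

lemma bounded_linear_ell2_nth: "bounded_linear (\<lambda>x. ell2_nth x k)"
  by (rule bounded_linear_intro[where K = 1])
     (simp_all add: plus_ell2.rep_eq scaleR_ell2.rep_eq scaleR_conv_of_real ell2_nth_le)

text \<open>
  In the following, \<open>E\<close> is \<open>f(T)\<close> for any function \<open>f\<close> that takes the same value \<open>w\<close> at the
  eigenvalues \<open>0\<close> and \<open>1\<close>.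
\<close>

context
  fixes f :: "complex \<Rightarrow> complex" and \<rho> :: real and E :: "ell2 \<Rightarrow> ell2" and w :: complex
  assumes f: "f holomorphic_on ball 0 \<rho>" and \<rho>: "2 < \<rho>" and f0: "f 0 = w" and f1: "f 1 = w"
  defines "E \<equiv> operator_series (\<lambda>n. (deriv ^^ n) f 0 / fact n) comp_op"
begin

lemma series_root_space: "root_space_on UNIV E w = UNIV"
proof -
  obtain K where "bounded_operator E K"
    using bounded_op_imp_bounded_operator[OF comp_op.bounded_op_series[OF comp_op.taylor_coeffs_summable[OF f \<rho>]]]
    unfolding E_def by blast
  then interpret E: bounded_operator E K .
  have sub: "root_vectors comp_op 0 \<subseteq> root_vectors E w" "root_vectors comp_op 1 \<subseteq> root_vectors E w"
    using comp_op.root_vectors_series[OF f \<rho>, of 0] comp_op.root_vectors_series[OF f \<rho>, of 1] \<rho>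
    by (simp_all add: f0 f1 E_def)
  have "unit_vec k \<in> root_vectors E w" for k
  proof (cases "is_sq k")
    case True
    have "(unit_vec k - block_vec k) + block_vec k \<in> root_vectors E w"
      using sub block_vec_root_vector[OF True] unit_vec_minus_block_vec_root_vector[OF True]
      by (intro csubspace_add[OF E.csubspace_root_vectors]) auto
    then show ?thesis by simp
  next
    case False
    have "unit_vec k \<in> root_vectors comp_op 0"
      using comp_op_funpow_unit_vec_nonsq[OF False]
      by (intro comp_op.root_vectorsI[where j = "Suc k"]) (simp only: shift_zero)
    then show ?thesis using sub by blast
  qed
  then show ?thesis
    unfolding root_space_eq_closure
    by (rule closure_eq_UNIV_if_unit_vecs[OF E.csubspace_root_vectors])
qed

text \<open>
  In the coordinates of a block, \<open>E\<close> is upper triangular with all diagonal entries equal to \<open>w\<close>: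
  the entry is \<open>f 1\<close> at the square that ends the block, and \<open>f 0\<close> elsewhere. The last nonzero
  coordinate of an eigenvector within some block determines the eigenvalue.
\<close>

lemma series_point_spectrum: "point_spectrum_on UNIV E = {w}"
proof -
  let ?c = "\<lambda>n. (deriv ^^ n) f 0 / fact n"
  have nth: "(\<lambda>n. ?c n * ell2_nth x ((advance ^^ n) k)) sums ell2_nth (E x) k" for x :: ell2 and k
    using bounded_linear.sums[OF bounded_linear_ell2_nth
        comp_op.series_sums[OF comp_op.taylor_coeffs_summable[OF f \<rho>]]]
    by (simp add: E_def scaleC_ell2.rep_eq ell2_nth_comp_op_funpow)
  have nth_sq: "ell2_nth (E x) k = w * ell2_nth x k" if "is_sq k" for x :: ell2 and k
  proof (rule sums_unique2[OF nth])
    have "(\<lambda>n. ?c n * 1 ^ n) sums w"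
      using holomorphic_power_series[OF f, of 1] \<rho> by (simp add: f1)
    from sums_mult2[OF this, of "ell2_nth x k"]
    show "(\<lambda>n. ?c n * ell2_nth x ((advance ^^ n) k)) sums (w * ell2_nth x k)"
      by (simp add: advance_funpow_sq[OF that])
  qed
  have nth_last: "ell2_nth (E x) k = w * ell2_nth x k"
    if "\<And>n. 0 < n \<Longrightarrow> ell2_nth x ((advance ^^ n) k) = 0" for x :: ell2 and k
  proof (rule sums_unique2[OF nth])
    have "(\<lambda>n. ?c n * ell2_nth x ((advance ^^ n) k)) sums (\<Sum>n\<in>{0}. ?c n * ell2_nth x ((advance ^^ n) k))"
      by (rule sums_finite) (use that in auto)
    then show "(\<lambda>n. ?c n * ell2_nth x ((advance ^^ n) k)) sums (w * ell2_nth x k)"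
      by (simp add: f0)
  qed
  have only: "\<mu> = w" if "x \<noteq> 0" "E x = \<mu> *\<^sub>C x" for x \<mu>
  proof -
    obtain k where k: "ell2_nth x k \<noteq> 0"
      using \<open>x \<noteq> 0\<close> ell2_eqI[of x 0] by (auto simp: zero_ell2.rep_eq)
    have "\<exists>l. ell2_nth x l \<noteq> 0 \<and> ell2_nth (E x) l = w * ell2_nth x l"
    proof -
      obtain j where j: "is_sq ((advance ^^ j) k)"
        using advance_reaches_sq by blast
      let ?N = "{n. ell2_nth x ((advance ^^ n) k) \<noteq> 0}"
      show ?thesis
      proof (cases "ell2_nth x ((advance ^^ j) k) = 0")
        case False
        then show ?thesis using nth_sq[OF j] by blast
      next
        case True
        have "n < j" if "n \<in> ?N" for n
        proof (rule ccontr)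
          assume "\<not> n < j"
          then have "(advance ^^ n) k = (advance ^^ (n - j)) ((advance ^^ j) k)"
            by (intro funpow_split) simp
          then show False using that True by (simp add: advance_funpow_sq[OF j])
        qed
        then have fin: "finite ?N" by (meson bounded_nat_set_is_finite)
        have "0 \<in> ?N" using k by simp
        then have max: "Max ?N \<in> ?N" using fin by (intro Max_in) blast+
        have "ell2_nth (E x) ((advance ^^ Max ?N) k) = w * ell2_nth x ((advance ^^ Max ?N) k)"
        proof (rule nth_last)
          fix n :: nat assume n: "0 < n"
          have "n + Max ?N \<notin> ?N"
            using Max_ge[OF fin, of "n + Max ?N"] n by auto
          then show "ell2_nth x ((advance ^^ n) ((advance ^^ Max ?N) k)) = 0"
            by (simp add: funpow_add)
        qed
        then show ?thesis using max by blast
      qed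
    qed
    then show ?thesis
      using that(2) by (auto simp: scaleC_ell2.rep_eq)
  qed
  have "E (unit_vec 0) = w *\<^sub>C unit_vec 0"
  proof (rule ell2_eqI)
    fix k
    have "ell2_nth (E (unit_vec 0)) k = w * ell2_nth (unit_vec 0) k"
    proof (cases "k = 0")
      case True
      then show ?thesis using nth_sq[OF is_sq_0] by simp
    next
      case False
      have "(advance ^^ n) k \<noteq> 0" for n
        using False by (induction n) (auto simp: advance_def)
      then show ?thesis by (intro nth_last) (simp add: unit_vec.rep_eq)
    qed
    then show "ell2_nth (E (unit_vec 0)) k = ell2_nth (w *\<^sub>C unit_vec 0) k"
      by (simp add: scaleC_ell2.rep_eq)
  qed
  moreover have "unit_vec 0 \<noteq> 0" using norm_unit_vec[of 0] by auto
  ultimately show ?thesis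
    unfolding point_spectrum_on_def using only by blast
qed

end

theorem theorem4p9:
  shows "\<exists>(H :: ell2 set) T \<Omega> f fT.
           separable_hilbert H \<and> bounded_op_on H T \<and>
           open \<Omega> \<and> bounded \<Omega> \<and> spectrum_on H T \<subseteq> \<Omega> \<and>
           f holomorphic_on \<Omega> \<and> (\<forall>z\<in>\<Omega>. deriv f z \<noteq> 0) \<and>
           riesz_dunford H T \<Omega> f fT \<and>
           root_spaces_unconditional_basis H fT \<and>
           \<not> root_spaces_unconditional_basis H T"
proof -
  let ?f = "\<lambda>z. exp (2 * of_real pi * \<i> * z)"
  let ?E = "operator_series (\<lambda>n. (deriv ^^ n) ?f 0 / fact n) comp_op"
  have f: "?f holomorphic_on ball 0 3" by (intro holomorphic_intros)
  have deriv: "deriv ?f z \<noteq> 0" for z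
  proof -
    have "(?f has_field_derivative (2 * of_real pi * \<i> * ?f z)) (at z)"
      by (auto intro!: derivative_eq_intros)
    then show ?thesis by (simp add: DERIV_imp_deriv)
  qed
  have vals: "?f 0 = 1" "?f 1 = 1" by simp_all
  have "root_spaces_unconditional_basis UNIV ?E"
    using series_point_spectrum[OF f _ vals] series_root_space[OF f _ vals]
    by (intro unconditional_basis_single_root_space) auto
  moreover have "riesz_dunford UNIV comp_op (ball 0 3) ?f ?E"
    by (rule comp_op.riesz_dunford_ball[OF f]) simp
  moreover have "spectrum_on UNIV comp_op \<subseteq> ball 0 3"
    using comp_op.spectrum_subset_cball by fastforce
  ultimately show ?thesis
    using separable_hilbert_UNIV comp_op.bounded_op f deriv comp_op_root_spaces_not_basis
    by (intro exI[of _ UNIV] exI[of _ comp_op] exI[of _ "ball 0 3"] exI[of _ ?f] exI[of _ ?E]) auto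
qed

end
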